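(* Let $\mathbb{K}$ be any finite or countable field. The following are equivalent: (a) there exists a strong Gross space $(E,\Phi)$ over $\mathbb{K}$; (b) there is a Luzin group $G\le\mathbb{K}^\omega$.
   Context: A Gross-type space over $\mathbb K$ is a pair $(E,\Phi)$ where $E$ is a $\mathbb{K}$-vector space of uncountable dimension and $\Phi:E^2\to\mathbb{K}$ is a symmetric bilinear form. For a subspace $U\le E$, $U^\perp=\{e\in E;\ \forall u\in U\,(\Phi(e,u)=0)\}$. $(E,\Phi)$ is strongly Gross iff for every countably-dimensional subspace $U\le E$, $\dim(U^\perp)\le\omega$. A linear $\mathbb{K}$-predictor is a pair $\pi=(D_\pi,(\pi_n;\,n\in D_\pi))$ with $D_\pi\subseteq\omega$ infinite and each $\pi_n:\mathbb{K}^n\to\mathbb{K}$ linear; $\pi$ predicts $g\in\mathbb{K}^\omega$ iff $\pi_n(g\restriction n)=g(n)$ for all but finitely many $n\in D_\pi$. A Luzin group is an uncountably-dimensional $\mathbb K$-linear subspace $G\le\mathbb{K}^\omega$ such that every linear $\mathbb{K}$-predictor predicts at most countably many elements of $G$. *)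

theory Defs
  imports
    "HOL-Library.Countable_Set"
    "HOL-Library.Function_Algebras"
    "Jordan_Normal_Form.Matrix"
begin

unbundle cardinal_syntax

text \<open>The dimension as a cardinal. The library function \<open>dim\<close> has values in \<^typ>\<open>nat\<close>
  and does not distinguish infinite dimensions.\<close>

definition (in vector_space) cdim :: "'b set \<Rightarrow> 'b rel" where
  "cdim V = |SOME B. independent B \<and> span B = span V|"

lemma (in vector_space) cdim_eq_card_of:
  assumes "independent B" and "span B = span V"
  shows "cdim V =o |B|"
proof -
  let ?C = "SOME B. independent B \<and> span B = span V"
  have "independent ?C \<and> span ?C = span V"
    by (rule someI_ex[where P = "\<lambda>B. independent B \<and> span B = span V"]) (use assms in blast)
  then obtain f where "bij_betw f ?C B"
    using bij_if_span_eq_span_bases assms by metis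
  then show ?thesis
    unfolding cdim_def by (rule card_of_ordIsoI)
qed

definition (in vector_space) symmetric_bilinear_on :: "'b set \<Rightarrow> ('b \<Rightarrow> 'b \<Rightarrow> 'a) \<Rightarrow> bool" where
  "symmetric_bilinear_on E \<Phi> \<longleftrightarrow>
    (\<forall>x\<in>E. \<forall>y\<in>E. \<Phi> x y = \<Phi> y x) \<and>
    (\<forall>x\<in>E. \<forall>y\<in>E. \<forall>z\<in>E. \<Phi> (x + y) z = \<Phi> x z + \<Phi> y z) \<and>
    (\<forall>x\<in>E. \<forall>y\<in>E. \<forall>z\<in>E. \<Phi> x (y + z) = \<Phi> x y + \<Phi> x z) \<and>
    (\<forall>c. \<forall>x\<in>E. \<forall>y\<in>E. \<Phi> (scale c x) y = c * \<Phi> x y) \<and>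
    (\<forall>c. \<forall>x\<in>E. \<forall>y\<in>E. \<Phi> x (scale c y) = c * \<Phi> x y)"

definition (in vector_space) gross_type_space :: "'b set \<Rightarrow> ('b \<Rightarrow> 'b \<Rightarrow> 'a) \<Rightarrow> bool" where
  "gross_type_space E \<Phi> \<longleftrightarrow>
    subspace E \<and> natLeq <o cdim E \<and> symmetric_bilinear_on E \<Phi>"

definition (in vector_space) orthogonal_complement :: "'b set \<Rightarrow> ('b \<Rightarrow> 'b \<Rightarrow> 'a) \<Rightarrow> 'b set \<Rightarrow> 'b set" where
  "orthogonal_complement E \<Phi> U = {e \<in> E. \<forall>u\<in>U. \<Phi> e u = 0}"

text \<open>The subspaces \<open>U\<close> range over those of dimension exactly \<open>\<omega>\<close>: for \<open>U = {0}\<close> the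
  orthogonal complement is all of \<open>E\<close>, so admitting finite-dimensional \<open>U\<close> would make the
  condition unsatisfiable.\<close>

definition (in vector_space) strong_gross_space :: "'b set \<Rightarrow> ('b \<Rightarrow> 'b \<Rightarrow> 'a) \<Rightarrow> bool" where
  "strong_gross_space E \<Phi> \<longleftrightarrow>
    gross_type_space E \<Phi> \<and>
    (\<forall>U. subspace U \<and> U \<subseteq> E \<and> cdim U =o natLeq \<longrightarrow>
      cdim (orthogonal_complement E \<Phi> U) \<le>o natLeq)"

definition seq_scale :: "'k::field \<Rightarrow> (nat \<Rightarrow> 'k) \<Rightarrow> nat \<Rightarrow> 'k" where
  "seq_scale c g = (\<lambda>n. c * g n)"

global_interpretation seq: vector_space seq_scale
  by unfold_locales (auto simp: seq_scale_def fun_eq_iff algebra_simps)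

definition linear_functional_on_vec :: "nat \<Rightarrow> ('k::field vec \<Rightarrow> 'k) \<Rightarrow> bool" where
  "linear_functional_on_vec n f \<longleftrightarrow>
    (\<forall>u\<in>carrier_vec n. \<forall>v\<in>carrier_vec n. f (u + v) = f u + f v) \<and>
    (\<forall>c. \<forall>v\<in>carrier_vec n. f (c \<cdot>\<^sub>v v) = c * f v)"

definition linear_predictor :: "nat set \<Rightarrow> (nat \<Rightarrow> 'k::field vec \<Rightarrow> 'k) \<Rightarrow> bool" where
  "linear_predictor D \<pi> \<longleftrightarrow> infinite D \<and> (\<forall>n\<in>D. linear_functional_on_vec n (\<pi> n))"

text \<open>The restriction \<open>g \<restriction> n\<close> is the vector \<open>vec n g\<close> with entries \<open>g 0, \<dots>, g (n - 1)\<close>.\<close>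

definition predicts :: "nat set \<Rightarrow> (nat \<Rightarrow> 'k::field vec \<Rightarrow> 'k) \<Rightarrow> (nat \<Rightarrow> 'k) \<Rightarrow> bool" where
  "predicts D \<pi> g \<longleftrightarrow> finite {n \<in> D. \<pi> n (vec n g) \<noteq> g n}"

definition luzin_group :: "(nat \<Rightarrow> 'k::field) set \<Rightarrow> bool" where
  "luzin_group G \<longleftrightarrow>
    seq.subspace G \<and> natLeq <o seq.cdim G \<and>
    (\<forall>D \<pi>. linear_predictor D \<pi> \<longrightarrow> countable {g \<in> G. predicts D \<pi> g})"

end

theory Submission
  imports Defs "HOL-Library.Countable_Set_Type"
begin

text \<open>From a strong Gross space to a Luzin group: fix independent \<open>u n\<close> in \<open>E\<close> and send \<open>e\<close> to the
  sequence \<open>n \<mapsto> \<Phi> e (u n)\<close>. A linear prediction at \<open>n\<close> succeeds iff \<open>e\<close> is orthogonal to \<open>u n\<close>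
  minus a combination of \<open>u 0, \<dots>, u (n - 1)\<close>. Cofinitely many of these vectors still span an
  infinite-dimensional space, so the predicted elements lie in a countable union of countable
  orthogonal complements. The case of the zero predictor shows that the image is uncountable.

  Conversely, let \<open>S\<close> be an independent subset of the Luzin group, well-ordered in type \<open>\<omega>\<^sub>1\<close>, and
  choose injections \<open>d a\<close> of the predecessors of \<open>a\<close> into \<open>\<omega>\<close> that are coherent modulo finite sets.
  On the span of \<open>S\<close> put \<open>\<Phi> a b = a (d a b)\<close> for \<open>b\<close> below \<open>a\<close>. A countable \<open>U\<close> lives below some
  \<open>\<gamma>\<close>; write \<open>e = y + h\<close> with \<open>y\<close> below \<open>\<gamma>\<close> and \<open>h\<close> supported from \<open>\<gamma>\<close> on. By coherence, on vectors
  of \<open>U\<close> that vanish on a finite set \<open>F\<close>, orthogonality of \<open>e\<close> is a family of affine conditions on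
  the sequence \<open>h\<close>, read through \<open>d \<gamma>\<close> and depending only on \<open>y\<close>. The difference of two solutions is
  predicted by a linear predictor that depends only on \<open>U\<close> and \<open>F\<close>, so each of the countably many
  pairs \<open>(y, F)\<close> admits countably many \<open>h\<close>.\<close>

section \<open>Orders with countable initial segments and coherent injections\<close>

text \<open>Well-order \<open>B\<close> and keep the points with countably many predecessors. If
  only countably many were kept, the least point left out would have all its predecessors among
  them, hence only countably many, and would have been kept.\<close>

lemma uncountable_subset_countable_initial_segments:
  fixes B :: "'a set"
  assumes "uncountable B"
  obtains S R where "S \<subseteq> B" "uncountable S" "R \<subseteq> S \<times> S" "wf R" "trans R" "total_on S R"
    "\<And>a. countable {b. (b, a) \<in> R}"
proof -
  obtain r where r: "well_order_on B r"
    using well_order_on by blast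
  define Q where "Q = r - Id"
  have lin: "linear_order_on B r" and wfQ: "wf Q"
    using r unfolding well_order_on_def Q_def by auto
  have transQ: "trans Q" and totQ: "total_on B Q" and subQ: "Q \<subseteq> B \<times> B"
    using lin unfolding Q_def linear_order_on_def partial_order_on_def preorder_on_def
    by (auto intro: trans_diff_Id)
  define S where "S = {b \<in> B. countable {c. (c, b) \<in> Q}}"
  define R where "R = Q \<inter> S \<times> S"
  have "uncountable S"
  proof
    assume cS: "countable S"
    have "B - S \<noteq> {}"
    proof
      assume "B - S = {}"
      then have "B \<subseteq> S" by blast
      then show False using countable_subset cS assms by blast
    qed
    then obtain m where m: "m \<in> B - S" "\<And>y. (y, m) \<in> Q \<Longrightarrow> y \<notin> B - S"
      by (rule wfE_min'[OF wfQ]) blast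
    then have "{c. (c, m) \<in> Q} \<subseteq> S" using subQ by auto
    then have "countable {c. (c, m) \<in> Q}" using cS countable_subset by blast
    then show False using m(1) by (simp add: S_def)
  qed
  moreover have "S \<subseteq> B" by (auto simp: S_def)
  moreover have "R \<subseteq> S \<times> S" by (auto simp: R_def)
  moreover have "wf R" using wfQ by (rule wf_subset) (auto simp: R_def)
  moreover have "trans R"
    using transQ unfolding R_def trans_def by blast
  moreover have "total_on S R"
    using totQ unfolding R_def total_on_def S_def by blast
  moreover have "countable {b. (b, a) \<in> R}" for a
  proof (cases "a \<in> S")
    case True
    then have "countable {c. (c, a) \<in> Q}" by (simp add: S_def)
    then show ?thesis by (rule countable_subset[rotated]) (auto simp: R_def)
  qed (auto simp: R_def)
  ultimately show ?thesis using that by blast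
qed

text \<open>In the proof, \<open>i a b\<close> is the first \<open>n\<close> for which \<open>b\<close> is at most the \<open>n\<close>-th
  predecessor \<open>e a n\<close> of \<open>a\<close>, and \<open>c a b\<close> is the maximum of \<open>i a b\<close> and \<open>c (e a (i a b)) b\<close>.
  The maximum makes \<open>c a\<close> finite-to-one. Below \<open>e a N\<close> only the indices \<open>n \<le> N\<close> occur, so there
  the comparison of \<open>c a\<close> with \<open>c (e a N)\<close> involves finitely many smaller instances.\<close>

lemma coherent_finite_to_one:
  fixes R :: "'a rel"
  assumes wf: "wf R" and sub: "R \<subseteq> S \<times> S" and trans: "trans R" and tot: "total_on S R"
    and ctbl: "\<And>a. countable {b. (b, a) \<in> R}"
  obtains c :: "'a \<Rightarrow> 'a \<Rightarrow> nat" where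
    "\<And>a k. finite {b. (b, a) \<in> R \<and> c a b \<le> k}"
    "\<And>a a'. (a', a) \<in> R \<Longrightarrow> finite {b. (b, a') \<in> R \<and> c a b \<noteq> c a' b}"
proof -
  define e where "e a = from_nat_into {b. (b, a) \<in> R}" for a
  define i where "i a b = (LEAST n. b = e a n \<or> (b, e a n) \<in> R)" for a b
  define F where "F f a b = (if b = e a (i a b) then i a b else max (i a b) (f (e a (i a b)) b))"
    for f :: "'a \<Rightarrow> 'a \<Rightarrow> nat" and a b
  define c where "c = wfrec R F"
  \<comment> \<open>The premise only ensures that \<open>a\<close> has a predecessor; on an empty
    set the value of \<open>from_nat_into\<close> carries no information.\<close>
  have e_in: "(e a n, a) \<in> R" if "(b, a) \<in> R" for a b n
    using from_nat_into[of "{b. (b, a) \<in> R}" n] that unfolding e_def by blast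
  have e_surj: "\<exists>n. b = e a n" if "(b, a) \<in> R" for a b
    using from_nat_into_surj[OF ctbl[of a], of b] that unfolding e_def by auto
  have i_prop: "b = e a (i a b) \<or> (b, e a (i a b)) \<in> R" if "(b, a) \<in> R" for a b
    unfolding i_def by (rule LeastI_ex) (use e_surj[OF that] in blast)
  have i_le: "i a b \<le> n" if "(b, e a n) \<in> R" for a b n
    unfolding i_def by (rule Least_le) (use that in blast)
  have c_eq: "c a b = (if b = e a (i a b) then i a b else max (i a b) (c (e a (i a b)) b))"
    if "(b, a) \<in> R" for a b
  proof -
    \<comment> \<open>The recursive call is made at \<open>e a (i a b)\<close>, which lies below
      \<open>a\<close>, so \<open>cut\<close> does not change its value.\<close>
    have "c a = F (cut c R a) a" unfolding c_def by (rule wfrec[OF wf])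
    then show ?thesis using e_in[OF that] by (simp add: F_def cut_apply)
  qed
  have fin: "finite {b. (b, a) \<in> R \<and> c a b \<le> k}" for a k
    using wf
  proof (induction a rule: wf_induct_rule)
    case (less a)
    show ?case
    proof (cases "\<exists>b. (b, a) \<in> R")
      case True
      then have below: "(e a n, a) \<in> R" for n using e_in by blast
      \<comment> \<open>A bound \<open>k\<close> on the maximum bounds both the index
        \<open>i a b\<close> and the recursive value, which leaves finitely many indices and a
        finite set for each.\<close>
      let ?T = "\<Union>n\<le>k. insert (e a n) {b. (b, e a n) \<in> R \<and> c (e a n) b \<le> k}"
      have "{b. (b, a) \<in> R \<and> c a b \<le> k} \<subseteq> ?T"
      proof
        fix b assume "b \<in> {b. (b, a) \<in> R \<and> c a b \<le> k}"
        then have b: "(b, a) \<in> R" "c a b \<le> k" by auto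
        then have "b = e a (i a b) \<and> i a b \<le> k \<or>
            (b, e a (i a b)) \<in> R \<and> i a b \<le> k \<and> c (e a (i a b)) b \<le> k"
          using c_eq[OF b(1)] i_prop[OF b(1)] by (auto split: if_splits)
        then show "b \<in> ?T" by blast
      qed
      moreover have "finite ?T" using less.IH[OF below] by auto
      ultimately show ?thesis by (rule finite_subset)
    qed auto
  qed
  have "\<forall>a'. (a', a) \<in> R \<longrightarrow> finite {b. (b, a') \<in> R \<and> c a b \<noteq> c a' b}" for a
    using wf
  proof (induction a rule: wf_induct_rule)
    case (less a)
    show ?case
    proof (intro allI impI)
      fix a' assume a': "(a', a) \<in> R"
      obtain N where N: "a' = e a N" using e_surj[OF a'] by blast
      have below: "(e a n, a) \<in> R" for n using e_in[OF a'] .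
      let ?D = "\<lambda>n. {b. (b, e a n) \<in> R \<and> (b, a') \<in> R \<and> c (e a n) b \<noteq> c a' b}"
      \<comment> \<open>The possible exceptions with index \<open>n\<close>: the point
        \<open>e a n\<close> itself, the points at which the index may decide the maximum, and those
        at which \<open>c (e a n)\<close> already differs from \<open>c a'\<close>.\<close>
      let ?T = "\<Union>n\<le>N. insert (e a n) ({b. (b, e a n) \<in> R \<and> c (e a n) b \<le> n} \<union> ?D n)"
      have "finite (?D n)" for n
      proof -
        \<comment> \<open>Both points lie below \<open>a\<close>, so the induction hypothesis
          applies to the larger of the two.\<close>
        consider "e a n = a'" | "(e a n, a') \<in> R" | "(a', e a n) \<in> R"
          using tot sub below[of n] a' unfolding total_on_def by blast
        then show ?thesis
        proof cases
          case 2
          then have "finite {b. (b, e a n) \<in> R \<and> c a' b \<noteq> c (e a n) b}"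
            using less.IH[OF a'] by blast
          then show ?thesis by (rule rev_finite_subset) auto
        next
          case 3
          then have "finite {b. (b, a') \<in> R \<and> c (e a n) b \<noteq> c a' b}"
            using less.IH[OF below[of n]] by blast
          then show ?thesis by (rule rev_finite_subset) auto
        qed auto
      qed
      then have "finite ?T" using fin by auto
      moreover have "{b. (b, a') \<in> R \<and> c a b \<noteq> c a' b} \<subseteq> ?T"
      proof
        fix b assume "b \<in> {b. (b, a') \<in> R \<and> c a b \<noteq> c a' b}"
        then have b: "(b, a') \<in> R" "c a b \<noteq> c a' b" by auto
        have ba: "(b, a) \<in> R" using b(1) a' trans by (blast dest: transD)
        have "i a b \<le> N" using i_le b N by blast
        moreover have "b = e a (i a b) \<or> (b, e a (i a b)) \<in> R \<and> c (e a (i a b)) b \<le> i a b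
            \<or> b \<in> ?D (i a b)"
          using c_eq[OF ba] i_prop[OF ba] b by (auto split: if_splits simp: max_def)
        ultimately show "b \<in> ?T" by blast
      qed
      ultimately show "finite {b. (b, a') \<in> R \<and> c a b \<noteq> c a' b}"
        using finite_subset by blast
    qed
  qed
  with fin show ?thesis using that by blast
qed

text \<open>A finite-to-one map becomes injective when each point is paired with its rank in its fibre.
  Two coherent maps have the same fibres below the smaller index, except for finitely many finite
  fibres, so coherence survives.\<close>

lemma coherent_injections:
  fixes R :: "'a rel"
  assumes wf: "wf R" and sub: "R \<subseteq> S \<times> S" and trans: "trans R" and tot: "total_on S R"
    and ctbl: "\<And>a. countable {b. (b, a) \<in> R}"
  obtains d :: "'a \<Rightarrow> 'a \<Rightarrow> nat" where
    "\<And>a. inj_on (d a) {b. (b, a) \<in> R}"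
    "\<And>a a'. (a', a) \<in> R \<Longrightarrow> finite {b. (b, a') \<in> R \<and> d a b \<noteq> d a' b}"
proof -
  obtain c :: "'a \<Rightarrow> 'a \<Rightarrow> nat" where
    fin: "\<And>a k. finite {b. (b, a) \<in> R \<and> c a b \<le> k}" and
    coh: "\<And>a a'. (a', a) \<in> R \<Longrightarrow> finite {b. (b, a') \<in> R \<and> c a b \<noteq> c a' b}"
    using coherent_finite_to_one[OF wf sub trans tot ctbl] by blast
  define fib where "fib a b = {x. (x, b) \<in> R \<and> c a x = c a b}" for a b
  define d where "d a b = prod_encode (c a b, card (fib a b))" for a b
  have "inj_on (d a) {b. (b, a) \<in> R}" for a
  proof (rule inj_onI)
    have *: False if xy: "(x, y) \<in> R" "(y, a) \<in> R" "d a x = d a y" for x y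
    proof -
      have eq: "c a x = c a y" "card (fib a x) = card (fib a y)"
        using xy(3) by (auto simp: d_def prod_encode_eq)
      have "fib a y \<subseteq> {b. (b, a) \<in> R \<and> c a b \<le> c a y}"
        using xy trans by (auto simp: fib_def dest: transD)
      then have fy: "finite (fib a y)"
        using fin finite_subset by blast
      have "fib a x \<subset> fib a y"
      proof -
        have "fib a x \<subseteq> fib a y" using eq xy trans by (auto simp: fib_def dest: transD)
        moreover have "x \<in> fib a y" using eq xy by (simp add: fib_def)
        moreover have "x \<notin> fib a x" using wf by (simp add: fib_def)
        ultimately show ?thesis by blast
      qed
      from psubset_card_mono[OF fy this] show False using eq(2) by simp
    qed
    fix x y assume xy: "x \<in> {b. (b, a) \<in> R}" "y \<in> {b. (b, a) \<in> R}" "d a x = d a y"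
    then consider "x = y" | "(x, y) \<in> R" | "(y, x) \<in> R"
      using tot sub unfolding total_on_def by blast
    then show "x = y" using *[of x y] *[of y x] xy by cases simp_all
  qed
  moreover have "finite {b. (b, a') \<in> R \<and> d a b \<noteq> d a' b}" if a': "(a', a) \<in> R" for a a'
  proof -
    let ?X = "{b. (b, a') \<in> R \<and> c a b \<noteq> c a' b}"
    \<comment> \<open>Off this set \<open>c a\<close> and \<open>c a'\<close> agree at
      \<open>b\<close>, and this common value exceeds every value that either map takes on
      \<open>?X\<close>. Hence no point of \<open>?X\<close> enters the fibre of \<open>b\<close>
      for either map, and the ranks agree.\<close>
    let ?T = "?X \<union> (\<Union>k \<in> c a ` ?X \<union> c a' ` ?X. {b. (b, a') \<in> R \<and> c a' b \<le> k})"
    have "{b. (b, a') \<in> R \<and> d a b \<noteq> d a' b} \<subseteq> ?T"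
    proof (rule subsetI, rule ccontr)
      fix b assume "b \<in> {b. (b, a') \<in> R \<and> d a b \<noteq> d a' b}" and nT: "b \<notin> ?T"
      then have b: "(b, a') \<in> R" "d a b \<noteq> d a' b" by auto
      have eq: "c a b = c a' b" using nT b by auto
      have "x \<in> fib a b \<longleftrightarrow> x \<in> fib a' b" for x
      proof (cases "x \<in> ?X")
        case True
        then have "\<not> c a' b \<le> c a x" "\<not> c a' b \<le> c a' x" using nT b(1) by blast+
        then show ?thesis using eq by (simp add: fib_def)
      next
        case False
        then have "c a x = c a' x" if "(x, b) \<in> R" using transD[OF trans that b(1)] by simp
        then show ?thesis using eq by (auto simp: fib_def)
      qed
      then have "fib a b = fib a' b" by blast
      then show False using b eq by (simp add: d_def)
    qed
    moreover have "finite ?T" using coh[OF a'] fin by auto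
    ultimately show ?thesis by (rule finite_subset)
  qed
  ultimately show ?thesis by (rule that)
qed

section \<open>Countable dimension and orthogonality\<close>

context vector_space
begin

lemma cdim_basis:
  assumes "subspace V"
  obtains B where "B \<subseteq> V" "independent B" "span B = V" "cdim V =o |B|"
proof -
  obtain B where B: "B \<subseteq> V" "independent B" "V \<subseteq> span B"
    using maximal_independent_subset by blast
  have "span V = V" using assms by (rule span_eq_iff[THEN iffD2])
  then have "span B = V" using B assms by (simp add: span_minimal subset_antisym)
  moreover from this have "cdim V =o |B|"
    using \<open>span V = V\<close> by (intro cdim_eq_card_of[OF B(2)]) (rule trans[OF _ sym])
  ultimately show ?thesis using that B by blast
qed

lemma countable_span:
  assumes K: "countable (UNIV :: 'a set)" and "countable B"
  shows "countable (span B)"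
proof -
  let ?f = "\<lambda>xs. sum_list (map (\<lambda>(c, b). c *s b) xs)"
  have "countable (?f ` lists (UNIV \<times> B))"
    using assms by (intro countable_image countable_lists countable_SIGMA) simp_all
  moreover have "span B \<subseteq> ?f ` lists (UNIV \<times> B)"
  proof
    fix x assume "x \<in> span B"
    then show "x \<in> ?f ` lists (UNIV \<times> B)"
    proof (induction rule: span_induct_alt)
      case base
      show ?case by (rule image_eqI[of _ _ "[]"]) simp_all
    next
      case (step c b y)
      then obtain xs where "xs \<in> lists (UNIV \<times> B)" "y = ?f xs" by blast
      with step(1) show ?case by (intro image_eqI[of _ _ "(c, b) # xs"]) simp_all
    qed
  qed
  ultimately show ?thesis by (rule countable_subset[rotated])
qed

text \<open>A countable basis over a countable field spans only countably many vectors. The later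
  arguments can therefore count vectors instead of basis elements.\<close>

lemma cdim_le_natLeq_iff:
  assumes K: "countable (UNIV :: 'a set)" and V: "subspace V"
  shows "cdim V \<le>o natLeq \<longleftrightarrow> countable V"
proof -
  obtain B where B: "B \<subseteq> V" "span B = V" "cdim V =o |B|"
    using cdim_basis[OF V] by blast
  have "cdim V \<le>o natLeq \<longleftrightarrow> |B| \<le>o natLeq"
    using B(3) ordIso_ordLeq_trans ordIso_symmetric by blast
  also have "\<dots> \<longleftrightarrow> countable B" by (simp add: countable_card_le_natLeq)
  also have "\<dots> \<longleftrightarrow> countable V"
  proof
    show "countable V" if "countable B" using countable_span[OF K that] B(2) by simp
    show "countable B" if "countable V" using B(1) that by (rule countable_subset)
  qed
  finally show ?thesis .
qed

lemma natLeq_less_cdim_iff: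
  assumes "countable (UNIV :: 'a set)" and "subspace V"
  shows "natLeq <o cdim V \<longleftrightarrow> uncountable V"
proof -
  have "Well_order (cdim V)" unfolding cdim_def by (rule card_of_Well_order)
  then show ?thesis
    using cdim_le_natLeq_iff[OF assms] not_ordLeq_iff_ordLess[OF natLeq_Well_order] by blast
qed

text \<open>An infinite independent set lies in no span of a finite set. This expresses infinite
  dimension without a choice of basis.\<close>

lemma cdim_eq_natLeq_iff:
  assumes K: "countable (UNIV :: 'a set)" and V: "subspace V"
  shows "cdim V =o natLeq \<longleftrightarrow> countable V \<and> (\<forall>T. finite T \<longrightarrow> \<not> V \<subseteq> span T)"
proof -
  obtain B where B: "B \<subseteq> V" "independent B" "span B = V" "cdim V =o |B|"
    using cdim_basis[OF V] by blast
  have inf: "infinite B \<longleftrightarrow> (\<forall>T. finite T \<longrightarrow> \<not> V \<subseteq> span T)"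
  proof
    assume "infinite B"
    then show "\<forall>T. finite T \<longrightarrow> \<not> V \<subseteq> span T"
      using B(1) independent_span_bound[OF _ B(2)] by blast
  next
    assume "\<forall>T. finite T \<longrightarrow> \<not> V \<subseteq> span T"
    then show "infinite B" using B(3) by blast
  qed
  have "cdim V =o natLeq \<longleftrightarrow> cdim V \<le>o natLeq \<and> natLeq \<le>o cdim V"
    by (rule ordIso_iff_ordLeq)
  moreover have "natLeq \<le>o cdim V \<longleftrightarrow> natLeq \<le>o |B|"
    using B(4) ordLeq_ordIso_trans ordIso_symmetric by blast
  moreover have "natLeq \<le>o |B| \<longleftrightarrow> infinite B" using infinite_iff_natLeq_ordLeq by blast
  ultimately show ?thesis using cdim_le_natLeq_iff[OF K V] inf by blast
qed

lemma symmetric_bilinear_onD: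
  assumes "symmetric_bilinear_on E \<Phi>"
  shows "x \<in> E \<Longrightarrow> y \<in> E \<Longrightarrow> \<Phi> x y = \<Phi> y x"
    and "x \<in> E \<Longrightarrow> y \<in> E \<Longrightarrow> z \<in> E \<Longrightarrow> \<Phi> (x + y) z = \<Phi> x z + \<Phi> y z"
    and "x \<in> E \<Longrightarrow> y \<in> E \<Longrightarrow> z \<in> E \<Longrightarrow> \<Phi> x (y + z) = \<Phi> x y + \<Phi> x z"
    and "x \<in> E \<Longrightarrow> y \<in> E \<Longrightarrow> \<Phi> (c *s x) y = c * \<Phi> x y"
    and "x \<in> E \<Longrightarrow> y \<in> E \<Longrightarrow> \<Phi> x (c *s y) = c * \<Phi> x y"
  using assms unfolding symmetric_bilinear_on_def by blast+

lemma bilinear_zero: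
  assumes "symmetric_bilinear_on E \<Phi>" "subspace E" "x \<in> E"
  shows "\<Phi> x 0 = 0" "\<Phi> 0 x = 0"
  using symmetric_bilinear_onD(5)[OF assms(1,3), of 0 0] subspace_0[OF assms(2)]
    symmetric_bilinear_onD(4)[OF assms(1) _ assms(3), of 0 0] by simp_all

lemma bilinear_diff:
  assumes "symmetric_bilinear_on E \<Phi>" "subspace E" "x \<in> E" "y \<in> E" "z \<in> E"
  shows "\<Phi> x (y - z) = \<Phi> x y - \<Phi> x z" "\<Phi> (y - z) x = \<Phi> y x - \<Phi> z x"
  using symmetric_bilinear_onD(3)[OF assms(1,3), of "y - z" z]
    symmetric_bilinear_onD(2)[OF assms(1), of "y - z" z x] subspace_diff[OF assms(2,4,5)] assms(3-5)
  by simp_all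

lemma bilinear_sum_scale:
  assumes "symmetric_bilinear_on E \<Phi>" "subspace E" "x \<in> E" "\<And>i. i \<in> I \<Longrightarrow> u i \<in> E"
  shows "\<Phi> x (\<Sum>i\<in>I. c i *s u i) = (\<Sum>i\<in>I. c i * \<Phi> x (u i))"
  using assms(4)
proof (induction I rule: infinite_finite_induct)
  case (insert i I)
  then have "(\<Sum>i\<in>I. c i *s u i) \<in> E" "c i *s u i \<in> E" "u i \<in> E"
    using assms(2) by (auto intro!: subspace_sum subspace_scale)
  with insert show ?case
    using assms(1,3) by (simp add: symmetric_bilinear_onD(3,5)[OF assms(1)])
qed (simp_all add: bilinear_zero[OF assms(1-3)])

lemma subspace_orthogonal_complement:
  assumes "symmetric_bilinear_on E \<Phi>" "subspace E" "U \<subseteq> E"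
  shows "subspace (orthogonal_complement E \<Phi> U)"
  unfolding orthogonal_complement_def
  using assms subsetD[OF assms(3)]
  by (intro subspaceI)
    (auto simp: bilinear_zero[OF assms(1,2)] symmetric_bilinear_onD(2,4)[OF assms(1)]
      subspace_0 subspace_add subspace_scale)

lemma orthogonal_span:
  assumes "symmetric_bilinear_on E \<Phi>" "subspace E" "B \<subseteq> E" "x \<in> E"
    and "\<And>b. b \<in> B \<Longrightarrow> \<Phi> x b = 0" and "y \<in> span B"
  shows "\<Phi> x y = 0"
proof -
  have "subspace {y \<in> E. \<Phi> x y = 0}"
    using assms(1,2,4)
    by (intro subspaceI) (auto simp: bilinear_zero symmetric_bilinear_onD(3,5)[OF assms(1)]
      subspace_0 subspace_add subspace_scale)
  then have "span B \<subseteq> {y \<in> E. \<Phi> x y = 0}"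
    using assms by (intro span_minimal) auto
  then show ?thesis using assms(6) by blast
qed

text \<open>Orthogonality to \<open>B\<close> extends to \<open>span B\<close>, which has dimension
  \<omega>, so the defining property of a strong Gross space applies to it. In this form generators
  suffice.\<close>

lemma strong_gross_space_countable_orthogonal:
  assumes "strong_gross_space E \<Phi>" "countable (UNIV :: 'a set)" "B \<subseteq> E" "countable B"
    and "\<And>T. finite T \<Longrightarrow> \<not> B \<subseteq> span T"
  shows "countable {x \<in> E. \<forall>b\<in>B. \<Phi> x b = 0}"
proof -
  have E: "subspace E" "symmetric_bilinear_on E \<Phi>"
    using assms(1) by (auto simp: strong_gross_space_def gross_type_space_def)
  have sub: "span B \<subseteq> E" using assms(3) E(1) by (rule span_minimal)
  have "cdim (span B) =o natLeq"
    using assms(2,4,5) span_superset[of B]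
    by (subst cdim_eq_natLeq_iff) (auto intro: countable_span)
  then have "cdim (orthogonal_complement E \<Phi> (span B)) \<le>o natLeq"
    using assms(1) sub unfolding strong_gross_space_def by (metis subspace_span)
  then have "countable (orthogonal_complement E \<Phi> (span B))"
    using cdim_le_natLeq_iff[OF assms(2) subspace_orthogonal_complement[OF E(2,1) sub]] by blast
  moreover have "{x \<in> E. \<forall>b\<in>B. \<Phi> x b = 0} \<subseteq> orthogonal_complement E \<Phi> (span B)"
    unfolding orthogonal_complement_def using orthogonal_span[OF E(2,1) assms(3)] by blast
  ultimately show ?thesis by (rule countable_subset[rotated])
qed

text \<open>Modulo the earlier \<open>u i\<close>, the vector \<open>w n\<close> equals
  \<open>u n\<close>. The \<open>w n\<close> thus have distinct leading terms and are independent,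
  so infinitely many of them exceed any finite bound on the dimension.\<close>

lemma triangular_not_finite_span:
  fixes u w :: "nat \<Rightarrow> 'b"
  assumes u: "independent (range u)" "inj u" and D: "infinite D"
    and w: "\<And>n. n \<in> D \<Longrightarrow> u n - w n \<in> span (u ` {..<n})" and T: "finite T"
  shows "\<not> w ` D \<subseteq> span T"
proof
  assume wT: "w ` D \<subseteq> span T"
  have ind: "N \<subseteq> D \<longrightarrow> independent (w ` N) \<and> card (w ` N) = card N" if "finite N" for N
    using that
  proof (induction N rule: finite_linorder_max_induct)
    case (insert n N)
    show ?case
    proof
      assume sub: "insert n N \<subseteq> D"
      have "w m \<in> span (u ` {..<n})" if "m \<in> N" for m
      proof -
        have m: "m < n" "m \<in> D" using that insert(2) sub by auto
        have "u m - w m \<in> span (u ` {..<n})"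
          using span_mono[of "u ` {..<m}" "u ` {..<n}"] w[OF m(2)] m(1) by fastforce
        moreover have "u m \<in> span (u ` {..<n})" using m(1) by (simp add: span_base)
        ultimately have "u m - (u m - w m) \<in> span (u ` {..<n})" by (rule span_diff[rotated])
        then show ?thesis by simp
      qed
      then have wN: "span (w ` N) \<subseteq> span (u ` {..<n})"
        by (intro span_minimal subspace_span) auto
      have un: "u n \<notin> span (u ` {..<n})"
      proof
        assume "u n \<in> span (u ` {..<n})"
        moreover have "u ` {..<n} \<subseteq> range u - {u n}" using u(2) by (auto dest: injD)
        ultimately have "u n \<in> span (range u - {u n})" using span_mono by blast
        then show False using u(1) unfolding dependent_def by blast
      qed
      have "w n \<notin> span (w ` N)"
      proof
        assume "w n \<in> span (w ` N)"
        then have "w n \<in> span (u ` {..<n})" using wN by blast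
        moreover have "u n - w n \<in> span (u ` {..<n})" using w sub by blast
        ultimately have "(u n - w n) + w n \<in> span (u ` {..<n})" by (intro span_add)
        then show False using un by simp
      qed
      moreover from this have "w n \<notin> w ` N" using span_base by blast
      moreover have "n \<notin> N" using insert(2) by blast
      ultimately show "independent (w ` insert n N) \<and> card (w ` insert n N) = card (insert n N)"
        using insert sub by (simp add: independent_insert)
    qed
  qed (simp add: independent_empty)
  obtain N where N: "finite N" "card N = Suc (card T)" "N \<subseteq> D"
    using infinite_arbitrarily_large[OF D] by blast
  then have "independent (w ` N)" "card (w ` N) = Suc (card T)" "w ` N \<subseteq> span T"
    using ind[OF N(1)] wT by auto
  then show False using independent_span_bound[OF T] by fastforce
qed

end

section \<open>From a strong Gross space to a Luzin group\<close>

lemma linear_functional_on_vec_expand: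
  assumes "linear_functional_on_vec n f"
  shows "f (vec n g) = (\<Sum>i<n. f (unit_vec n i) * g i)"
proof -
  have add: "f (u + v) = f u + f v" if "u \<in> carrier_vec n" "v \<in> carrier_vec n" for u v
    using assms that by (simp add: linear_functional_on_vec_def)
  have scale: "f (c \<cdot>\<^sub>v v) = c * f v" if "v \<in> carrier_vec n" for c v
    using assms that by (simp add: linear_functional_on_vec_def)
  \<comment> \<open>The induction is on the number of entries kept. The length stays
    \<open>n\<close>, because \<open>f\<close> is linear on vectors of that length only.\<close>
  have "m \<le> n \<Longrightarrow> f (vec n (\<lambda>i. if i < m then g i else 0)) = (\<Sum>i<m. f (unit_vec n i) * g i)" for m
  proof (induction m)
    case 0
    have "vec n (\<lambda>i. if i < 0 then g i else 0) = 0 \<cdot>\<^sub>v vec n g" by auto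
    then show ?case using scale[of "vec n g" 0] by simp
  next
    case (Suc m)
    have "vec n (\<lambda>i. if i < Suc m then g i else 0) =
        vec n (\<lambda>i. if i < m then g i else 0) + g m \<cdot>\<^sub>v unit_vec n m"
      using Suc.prems by (auto simp: vec_eq_iff unit_vec_def less_Suc_eq)
    then show ?case using Suc by (simp add: add scale mult.commute)
  qed
  from this[of n] have "f (vec n (\<lambda>i. if i < n then g i else 0)) = (\<Sum>i<n. f (unit_vec n i) * g i)"
    by simp
  moreover have "vec n (\<lambda>i. if i < n then g i else 0) = vec n g" by (auto simp: vec_eq_iff)
  ultimately show ?thesis by simp
qed

lemma (in vector_space) strong_gross_imp_luzin:
  fixes E :: "'b set" and \<Phi> :: "'b \<Rightarrow> 'b \<Rightarrow> 'a"
  assumes K: "countable (UNIV :: 'a set)" and SG: "strong_gross_space E \<Phi>"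
  shows "\<exists>G :: (nat \<Rightarrow> 'a) set. luzin_group G"
proof -
  have gt: "gross_type_space E \<Phi>" using SG by (simp add: strong_gross_space_def)
  then have E: "subspace E" and sb: "symmetric_bilinear_on E \<Phi>" and unc: "uncountable E"
    using K by (auto simp: gross_type_space_def natLeq_less_cdim_iff)
  obtain B where B: "B \<subseteq> E" "independent B" "span B = E"
    using cdim_basis[OF E] by blast
  have "infinite B" using countable_span[OF K, of B] unc B(3) countable_finite by blast
  then obtain u :: "nat \<Rightarrow> 'b" where u: "inj u" "range u \<subseteq> B"
    using infinite_countable_subset by blast
  have indu: "independent (range u)" using u(2) B(2) dependent_mono by blast
  have uE: "u n \<in> E" for n using u(2) B(1) by blast
  define \<gamma> where "\<gamma> e = (\<lambda>n. \<Phi> e (u n))" for e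
  define G where "G = \<gamma> ` E"
  \<comment> \<open>Used twice: with \<open>w = u\<close> to bound the fibres of
    \<open>\<gamma>\<close>, and with \<open>u n - v n\<close> to bound the sequences
    predicted.\<close>
  have tri: "countable {x \<in> E. \<forall>n\<in>D. \<Phi> x (w n) = 0}"
    if "infinite D" "\<And>n. n \<in> D \<Longrightarrow> u n - w n \<in> span (u ` {..<n})" for D w
  proof -
    have "w n \<in> E" if "n \<in> D" for n
    proof -
      have "span (u ` {..<n}) \<subseteq> E" using E uE by (intro span_minimal) auto
      then have "u n - (u n - w n) \<in> E"
        using \<open>n \<in> D\<close> \<open>\<And>n. n \<in> D \<Longrightarrow> u n - w n \<in> _\<close> by (blast intro: subspace_diff[OF E uE])
      then show ?thesis by simp
    qed
    then have "countable {x \<in> E. \<forall>b\<in>w ` D. \<Phi> x b = 0}"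
      using triangular_not_finite_span[OF indu u(1) that]
      by (intro strong_gross_space_countable_orthogonal[OF SG K]) auto
    then show ?thesis by simp
  qed
  have subG: "seq.subspace G"
    unfolding seq.subspace_def
  proof (intro conjI ballI allI)
    have "\<gamma> 0 = 0" by (simp add: \<gamma>_def bilinear_zero[OF sb E uE] fun_eq_iff)
    then show "0 \<in> G" unfolding G_def using subspace_0[OF E] by (metis image_eqI)
  next
    fix x y assume "x \<in> G" "y \<in> G"
    then obtain a b where ab: "a \<in> E" "b \<in> E" "x = \<gamma> a" "y = \<gamma> b" by (auto simp: G_def)
    then have "x + y = \<gamma> (a + b)"
      by (simp add: \<gamma>_def fun_eq_iff symmetric_bilinear_onD(2)[OF sb] uE)
    then show "x + y \<in> G" unfolding G_def using ab subspace_add[OF E] by blast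
  next
    fix c x assume "x \<in> G"
    then obtain a where a: "a \<in> E" "x = \<gamma> a" by (auto simp: G_def)
    then have "seq_scale c x = \<gamma> (c *s a)"
      by (simp add: \<gamma>_def fun_eq_iff seq_scale_def symmetric_bilinear_onD(4)[OF sb] uE)
    then show "seq_scale c x \<in> G" unfolding G_def using a subspace_scale[OF E] by blast
  qed
  have uncG: "uncountable G"
  proof
    assume cG: "countable G"
    \<comment> \<open>A nonempty fibre of \<open>\<gamma>\<close> is a translate of its kernel, the
      set of vectors orthogonal to every \<open>u n\<close>.\<close>
    have "countable {e \<in> E. \<gamma> e = g}" for g
    proof (cases "\<exists>e0\<in>E. \<gamma> e0 = g")
      case True
      then obtain e0 where e0: "e0 \<in> E" "\<gamma> e0 = g" by blast
      let ?Z = "{x \<in> E. \<forall>n\<in>UNIV. \<Phi> x (u n) = 0}"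
      have "countable ?Z" by (intro tri) (auto simp: span_zero)
      moreover have "{e \<in> E. \<gamma> e = g} \<subseteq> (\<lambda>z. e0 + z) ` ?Z"
      proof
        fix e assume e: "e \<in> {e \<in> E. \<gamma> e = g}"
        then have "e - e0 \<in> ?Z"
          using e0 bilinear_diff(2)[OF sb E uE _ e0(1)] subspace_diff[OF E _ e0(1)]
          by (auto simp: \<gamma>_def fun_eq_iff)
        then show "e \<in> (\<lambda>z. e0 + z) ` ?Z" by (intro image_eqI[of _ _ "e - e0"]) simp_all
      qed
      ultimately show ?thesis by (rule countable_subset[rotated, OF countable_image])
    next
      case False
      then have "{e \<in> E. \<gamma> e = g} = {}" by blast
      then show ?thesis by (simp only: countable_empty)
    qed
    then have "countable (\<Union>g\<in>G. {e \<in> E. \<gamma> e = g})" using cG by blast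
    moreover have "(\<Union>g\<in>G. {e \<in> E. \<gamma> e = g}) = E" by (auto simp: G_def)
    ultimately show False using unc by simp
  qed
  have "countable {g \<in> G. predicts D \<pi> g}" if \<pi>: "linear_predictor D \<pi>" for D \<pi>
  proof -
    have D: "infinite D" and lin: "\<And>n. n \<in> D \<Longrightarrow> linear_functional_on_vec n (\<pi> n)"
      using \<pi> by (auto simp: linear_predictor_def)
    \<comment> \<open>Chosen so that pairing \<open>e\<close> with \<open>v n\<close> gives the
      prediction for \<open>\<gamma> e\<close> at \<open>n\<close>; a correct prediction then means
      that \<open>e\<close> is orthogonal to \<open>u n - v n\<close>.\<close>
    define v where "v n = (\<Sum>i<n. \<pi> n (unit_vec n i) *s u i)" for n
    have vE: "v n \<in> E" for n unfolding v_def using E uE by (intro subspace_sum subspace_scale)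
    have eq: "\<Phi> e (u n - v n) = \<gamma> e n - \<pi> n (vec n (\<gamma> e))" if "e \<in> E" "n \<in> D" for e n
    proof -
      have "\<Phi> e (v n) = \<pi> n (vec n (\<gamma> e))"
        unfolding v_def bilinear_sum_scale[OF sb E that(1) uE]
          linear_functional_on_vec_expand[OF lin[OF that(2)]] by (simp add: \<gamma>_def)
      then show ?thesis using bilinear_diff(1)[OF sb E that(1) uE vE] by (simp add: \<gamma>_def)
    qed
    \<comment> \<open>\<open>Z k\<close> collects the vectors whose sequences are predicted without
      error from \<open>k\<close> on. Finitely many errors lie below some \<open>k\<close>.\<close>
    define Z where "Z k = {x \<in> E. \<forall>n\<in>D \<inter> {k..}. \<Phi> x (u n - v n) = 0}" for k
    have "countable (Z k)" for k
      unfolding Z_def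
    proof (rule tri)
      have "D \<inter> {k..} = D - {..<k}" by auto
      then show "infinite (D \<inter> {k..})" using D by simp
      have "v n \<in> span (u ` {..<n})" for n
        unfolding v_def by (rule span_sum) (simp add: span_scale span_base)
      then show "u n - (u n - v n) \<in> span (u ` {..<n})" for n by simp
    qed
    then have "countable (\<Union>k. \<gamma> ` Z k)" by blast
    moreover have "{g \<in> G. predicts D \<pi> g} \<subseteq> (\<Union>k. \<gamma> ` Z k)"
    proof
      fix g assume "g \<in> {g \<in> G. predicts D \<pi> g}"
      then obtain e where e: "e \<in> E" "g = \<gamma> e" and fin: "finite {n \<in> D. \<pi> n (vec n g) \<noteq> g n}"
        by (auto simp: G_def predicts_def)
      obtain k where k: "\<And>n. n \<in> {n \<in> D. \<pi> n (vec n g) \<noteq> g n} \<Longrightarrow> n < k"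
        using fin unfolding finite_nat_set_iff_bounded by blast
      have "\<Phi> e (u n - v n) = 0" if n: "n \<in> D \<inter> {k..}" for n
      proof -
        have "\<pi> n (vec n g) = g n" using k[of n] n by auto
        then show ?thesis using eq[OF e(1), of n] n e(2) by simp
      qed
      then have "e \<in> Z k" using e(1) by (simp add: Z_def)
      then show "g \<in> (\<Union>k. \<gamma> ` Z k)" using e by blast
    qed
    ultimately show ?thesis by (rule countable_subset[rotated])
  qed
  then have "luzin_group G"
    unfolding luzin_group_def using subG uncG seq.natLeq_less_cdim_iff[OF K subG] by blast
  then show ?thesis by blast
qed

section \<open>Extension of forms from a basis, and vanishing coordinates\<close>

definition (in vector_space) linear_extension :: "'b set \<Rightarrow> ('b \<Rightarrow> 'a) \<Rightarrow> 'b \<Rightarrow> 'a" where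
  "linear_extension B f x =
    (\<Sum>b | representation B x b \<noteq> 0. representation B x b * f b)"

definition (in vector_space) bilinear_extension :: "'b set \<Rightarrow> ('b \<Rightarrow> 'b \<Rightarrow> 'a) \<Rightarrow> 'b \<Rightarrow> 'b \<Rightarrow> 'a" where
  "bilinear_extension B \<phi> x y = linear_extension B (\<lambda>a. linear_extension B (\<phi> a) y) x"

context vector_space
begin

text \<open>Different vectors have different supports; a common finite index set makes their sums
  comparable.\<close>

lemma linear_extension_superset:
  assumes "finite T" "{b. representation B x b \<noteq> 0} \<subseteq> T"
  shows "linear_extension B f x = (\<Sum>b\<in>T. representation B x b * f b)"
  unfolding linear_extension_def by (rule sum.mono_neutral_left) (use assms in auto)

lemma linear_extension_basis:
  assumes "independent B" "b \<in> B"
  shows "linear_extension B f b = f b"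
proof -
  have "linear_extension B f b = (\<Sum>a\<in>{b}. representation B b a * f a)"
    by (rule linear_extension_superset) (auto simp: representation_basis[OF assms])
  then show ?thesis by (simp add: representation_basis[OF assms])
qed

lemma linear_extension_add:
  assumes "independent B" "x \<in> span B" "y \<in> span B"
  shows "linear_extension B f (x + y) = linear_extension B f x + linear_extension B f y"
proof -
  let ?T = "{b. representation B x b \<noteq> 0} \<union> {b. representation B y b \<noteq> 0}"
  have T: "finite ?T" by (simp add: finite_representation)
  have r: "representation B (x + y) = (\<lambda>b. representation B x b + representation B y b)"
    using assms by (intro representation_add)
  have "linear_extension B f (x + y) = (\<Sum>b\<in>?T. representation B (x + y) b * f b)"
    by (rule linear_extension_superset[OF T]) (auto simp: r)
  also have "\<dots> = (\<Sum>b\<in>?T. representation B x b * f b) + (\<Sum>b\<in>?T. representation B y b * f b)"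
    by (simp add: r distrib_right sum.distrib)
  also have "\<dots> = linear_extension B f x + linear_extension B f y"
    using linear_extension_superset[OF T, of B x f] linear_extension_superset[OF T, of B y f]
    by auto
  finally show ?thesis .
qed

lemma linear_extension_scale:
  assumes "independent B" "x \<in> span B"
  shows "linear_extension B f (c *s x) = c * linear_extension B f x"
proof -
  let ?T = "{b. representation B x b \<noteq> 0}"
  have T: "finite ?T" by (simp add: finite_representation)
  have r: "representation B (c *s x) = (\<lambda>b. c * representation B x b)"
    using assms by (rule representation_scale)
  have "linear_extension B f (c *s x) = (\<Sum>b\<in>?T. representation B (c *s x) b * f b)"
    by (rule linear_extension_superset[OF T]) (auto simp: r)
  also have "\<dots> = c * linear_extension B f x"
    by (simp add: r linear_extension_def sum_distrib_left mult.assoc)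
  finally show ?thesis .
qed

lemma bilinear_extension_basis:
  assumes "independent B" "a \<in> B"
  shows "bilinear_extension B \<phi> a y = linear_extension B (\<phi> a) y"
  using assms by (simp add: bilinear_extension_def linear_extension_basis)

lemma bilinear_extension_commute:
  assumes "\<And>a b. \<phi> a b = \<phi> b a"
  shows "bilinear_extension B \<phi> x y = bilinear_extension B \<phi> y x"
proof -
  let ?r = "representation B"
  have "bilinear_extension B \<phi> x y =
      (\<Sum>a | ?r x a \<noteq> 0. \<Sum>b | ?r y b \<noteq> 0. ?r x a * (?r y b * \<phi> a b))"
    by (simp add: bilinear_extension_def linear_extension_def sum_distrib_left)
  also have "\<dots> = (\<Sum>b | ?r y b \<noteq> 0. \<Sum>a | ?r x a \<noteq> 0. ?r x a * (?r y b * \<phi> a b))"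
    by (rule sum.swap)
  also have "\<dots> = (\<Sum>b | ?r y b \<noteq> 0. \<Sum>a | ?r x a \<noteq> 0. ?r y b * (?r x a * \<phi> b a))"
    by (intro sum.cong refl) (simp add: mult.left_commute assms)
  also have "\<dots> = bilinear_extension B \<phi> y x"
    by (simp add: bilinear_extension_def linear_extension_def sum_distrib_left)
  finally show ?thesis .
qed

lemma symmetric_bilinear_on_bilinear_extension:
  assumes B: "independent B" and comm: "\<And>a b. \<phi> a b = \<phi> b a"
  shows "symmetric_bilinear_on (span B) (bilinear_extension B \<phi>)"
proof -
  let ?\<Phi> = "bilinear_extension B \<phi>"
  have sym: "?\<Phi> x y = ?\<Phi> y x" for x y using comm by (rule bilinear_extension_commute)
  have add: "?\<Phi> (x + y) z = ?\<Phi> x z + ?\<Phi> y z" if "x \<in> span B" "y \<in> span B" for x y z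
    unfolding bilinear_extension_def using B that by (rule linear_extension_add)
  have scale: "?\<Phi> (c *s x) z = c * ?\<Phi> x z" if "x \<in> span B" for c x z
    unfolding bilinear_extension_def using B that by (rule linear_extension_scale)
  have add': "?\<Phi> z (x + y) = ?\<Phi> z x + ?\<Phi> z y" if "x \<in> span B" "y \<in> span B" for x y z
    using add[OF that, of z] by (simp only: sym[of z])
  have scale': "?\<Phi> z (c *s x) = c * ?\<Phi> z x" if "x \<in> span B" for c x z
    using scale[OF that, of c z] by (simp only: sym[of z])
  show ?thesis
    unfolding symmetric_bilinear_on_def
    by (intro conjI ballI allI) (rule sym add scale add' scale'; assumption)+
qed

text \<open>Each coordinate condition lowers the dimension by at most one: if \<open>v\<close> has a
  nonzero coordinate at \<open>q\<close>, subtracting a multiple of \<open>v\<close> from any vector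
  makes its coordinate at \<open>q\<close> vanish.\<close>

lemma exists_vanishing_on_finite:
  assumes B: "independent B" and U: "subspace U" "U \<subseteq> span B"
    and inf: "\<And>T. finite T \<Longrightarrow> \<not> U \<subseteq> span T" and Q: "finite Q"
  shows "\<exists>u\<in>U. u \<noteq> 0 \<and> (\<forall>q\<in>Q. representation B u q = 0)"
proof -
  let ?V = "\<lambda>Q. {u \<in> U. \<forall>q\<in>Q. representation B u q = 0}"
  \<comment> \<open>The induction needs infinite dimension of the remaining space, not just a
    nonzero vector in it.\<close>
  have "\<forall>T. finite T \<longrightarrow> \<not> ?V Q \<subseteq> span T"
    using Q
  proof (induction Q)
    case empty
    then show ?case using inf by simp
  next
    case (insert q Q)
    show ?case
    proof (intro allI impI notI)
      fix T assume T: "finite T" "?V (insert q Q) \<subseteq> span T"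
      show False
      proof (cases "\<exists>v\<in>?V Q. representation B v q \<noteq> 0")
        case False
        then have "?V Q \<subseteq> ?V (insert q Q)" by blast
        then have "?V Q \<subseteq> span T" using T(2) by (rule subset_trans)
        then show False using insert.IH T(1) by simp
      next
        case True
        then obtain v where v: "v \<in> ?V Q" "representation B v q \<noteq> 0" by blast
        have "?V Q \<subseteq> span (insert v T)"
        proof
          fix u assume u: "u \<in> ?V Q"
          let ?k = "representation B u q / representation B v q"
          have UB: "u \<in> span B" "v \<in> span B" "?k *s v \<in> span B"
            using u v U(2) by (auto intro: span_scale)
          have "representation B (u - ?k *s v) =
              (\<lambda>b. representation B u b - ?k * representation B v b)"
            using representation_diff[OF B UB(3,1)] representation_scale[OF B UB(2), of ?k]
            by simp
          moreover have "u - ?k *s v \<in> U"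
            using u v U(1) by (simp add: subspace_diff subspace_scale)
          ultimately have "u - ?k *s v \<in> ?V (insert q Q)"
            using u v by simp
          then have "u - ?k *s v \<in> span T" using T(2) by blast
          then have "u - ?k *s v \<in> span (insert v T)"
            using span_mono[of T "insert v T"] by blast
          moreover have "?k *s v \<in> span (insert v T)" by (intro span_scale span_base) simp
          ultimately have "(u - ?k *s v) + ?k *s v \<in> span (insert v T)" by (rule span_add)
          then show "u \<in> span (insert v T)" by simp
        qed
        moreover have "finite (insert v T)" using T(1) by simp
        ultimately show False using insert.IH by simp
      qed
    qed
  qed
  from this[rule_format, of "{}"] show ?thesis by auto
qed

end

section \<open>Linear conditions on a Luzin group\<close>

text \<open>Since the coefficient \<open>w n n\<close> is nonzero, the condition at \<open>n\<close>
  can be solved for \<open>g n\<close> in terms of earlier entries. The solution formulas form a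
  linear predictor.\<close>

lemma luzin_countable_annihilator:
  fixes G :: "(nat \<Rightarrow> 'k::field) set"
  assumes G: "luzin_group G" and D: "infinite D" and lead: "\<And>n. n \<in> D \<Longrightarrow> w n n \<noteq> 0"
  shows "countable {g \<in> G. \<forall>n\<in>D. (\<Sum>i\<le>n. w n i * g i) = 0}"
proof -
  define \<pi> where "\<pi> n v = - (\<Sum>i<n. (w n i / w n n) * v $ i)" for n and v :: "'k vec"
  have "linear_functional_on_vec n (\<pi> n)" for n
    unfolding linear_functional_on_vec_def \<pi>_def
    by (auto simp: algebra_simps add_divide_distrib sum.distrib sum_distrib_left intro!: sum.cong)
  then have "countable {g \<in> G. predicts D \<pi> g}"
    using G D by (simp add: luzin_group_def linear_predictor_def)
  moreover have "{g \<in> G. \<forall>n\<in>D. (\<Sum>i\<le>n. w n i * g i) = 0} \<subseteq> {g \<in> G. predicts D \<pi> g}"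
  proof safe
    fix g assume g: "\<forall>n\<in>D. (\<Sum>i\<le>n. w n i * g i) = 0"
    have "\<pi> n (vec n g) = g n" if n: "n \<in> D" for n
    proof -
      have "(\<Sum>i<n. w n i * g i) = - (w n n * g n)"
        using g[rule_format, OF n] by (simp add: lessThan_Suc_atMost[symmetric] eq_neg_iff_add_eq_0)
      moreover have "\<pi> n (vec n g) = - ((\<Sum>i<n. w n i * g i) / w n n)"
        by (simp add: \<pi>_def sum_divide_distrib)
      ultimately show ?thesis using lead[OF n] by simp
    qed
    then have "{n \<in> D. \<pi> n (vec n g) \<noteq> g n} = {}" by blast
    then show "predicts D \<pi> g" unfolding predicts_def by (simp only: finite.emptyI)
  qed
  ultimately show ?thesis by (rule countable_subset[rotated])
qed

text \<open>The leading positions of the functionals are unbounded, so choosing one functional for each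
  leading position gives a predictor.\<close>

lemma luzin_countable_common_zeros:
  fixes G :: "(nat \<Rightarrow> 'k::field) set" and c :: "'u \<Rightarrow> 'b \<Rightarrow> 'k" and j :: "'b \<Rightarrow> nat"
  assumes G: "luzin_group G" and j: "inj_on j T"
    and c: "\<And>u. u \<in> V \<Longrightarrow> finite {b. c u b \<noteq> 0}" "\<And>u. u \<in> V \<Longrightarrow> {b. c u b \<noteq> 0} \<subseteq> T"
    and unb: "\<And>N. \<exists>u\<in>V. \<exists>b. c u b \<noteq> 0 \<and> N \<le> j b"
  shows "countable {g \<in> G. \<forall>u\<in>V. (\<Sum>b | c u b \<noteq> 0. c u b * g (j b)) = 0}"
proof -
  define D where "D = {Max (j ` {b. c u b \<noteq> 0}) | u. u \<in> V \<and> {b. c u b \<noteq> 0} \<noteq> {}}"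
  have "\<exists>n\<in>D. N \<le> n" for N
  proof -
    obtain u b where u: "u \<in> V" "c u b \<noteq> 0" "N \<le> j b" using unb by blast
    then have "j b \<le> Max (j ` {b. c u b \<noteq> 0})" using c(1) by (intro Max_ge) auto
    moreover have "Max (j ` {b. c u b \<noteq> 0}) \<in> D" using u unfolding D_def by blast
    ultimately show ?thesis using u(3) le_trans by blast
  qed
  then have D: "infinite D" by (metis infinite_nat_iff_unbounded_le)
  have "\<exists>u\<in>V. n = Max (j ` {b. c u b \<noteq> 0}) \<and> {b. c u b \<noteq> 0} \<noteq> {}" if "n \<in> D" for n
    using that unfolding D_def by blast
  then obtain \<upsilon> where \<upsilon>: "\<And>n. n \<in> D \<Longrightarrow> \<upsilon> n \<in> V"
      "\<And>n. n \<in> D \<Longrightarrow> n = Max (j ` {b. c (\<upsilon> n) b \<noteq> 0})"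
      "\<And>n. n \<in> D \<Longrightarrow> {b. c (\<upsilon> n) b \<noteq> 0} \<noteq> {}"
    by metis
  \<comment> \<open>Collects the coefficients by position. For \<open>n\<close> in \<open>D\<close>
    each sum has at most one term, as \<open>j\<close> is injective on the supports, so the leading
    coefficient cannot cancel.\<close>
  define w where "w n i = (\<Sum>b | c (\<upsilon> n) b \<noteq> 0 \<and> j b = i. c (\<upsilon> n) b)" for n i
  have jle: "j b \<le> n" if "n \<in> D" "c (\<upsilon> n) b \<noteq> 0" for n b
  proof -
    have "j b \<le> Max (j ` {b. c (\<upsilon> n) b \<noteq> 0})" using that c(1) \<upsilon>(1) by (intro Max_ge) auto
    then show ?thesis using \<upsilon>(2)[OF that(1)] by simp
  qed
  have lead: "w n n \<noteq> 0" if n: "n \<in> D" for n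
  proof -
    have "Max (j ` {b. c (\<upsilon> n) b \<noteq> 0}) \<in> j ` {b. c (\<upsilon> n) b \<noteq> 0}"
      using c(1) \<upsilon>(1,3) n by (intro Max_in) auto
    then obtain b where b: "c (\<upsilon> n) b \<noteq> 0" "j b = n" using \<upsilon>(2)[OF n] by auto
    then have "{b. c (\<upsilon> n) b \<noteq> 0 \<and> j b = n} = {b}"
      using j c(2)[OF \<upsilon>(1)[OF n]] by (auto dest: inj_onD)
    then show ?thesis using b by (simp add: w_def)
  qed
  have eq: "(\<Sum>i\<le>n. w n i * g i) = (\<Sum>b | c (\<upsilon> n) b \<noteq> 0. c (\<upsilon> n) b * g (j b))"
    if n: "n \<in> D" for n and g :: "nat \<Rightarrow> 'k"
  proof -
    let ?A = "{b. c (\<upsilon> n) b \<noteq> 0}"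
    have "(\<Sum>b\<in>?A. c (\<upsilon> n) b * g (j b)) =
        (\<Sum>i\<le>n. \<Sum>b\<in>{b \<in> ?A. j b = i}. c (\<upsilon> n) b * g (j b))"
      using c(1) \<upsilon>(1) n jle by (intro sum.group[symmetric]) auto
    also have "\<dots> = (\<Sum>i\<le>n. w n i * g i)"
      by (auto simp: w_def sum_distrib_right intro!: sum.cong)
    finally show ?thesis by simp
  qed
  have "countable {g \<in> G. \<forall>n\<in>D. (\<Sum>i\<le>n. w n i * g i) = 0}"
    by (rule luzin_countable_annihilator[OF G D lead])
  moreover have "{g \<in> G. \<forall>u\<in>V. (\<Sum>b | c u b \<noteq> 0. c u b * g (j b)) = 0} \<subseteq>
      {g \<in> G. \<forall>n\<in>D. (\<Sum>i\<le>n. w n i * g i) = 0}"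
    using \<upsilon>(1) by (auto simp: eq)
  ultimately show ?thesis by (rule countable_subset[rotated])
qed

text \<open>A nonempty solution set is contained in a translate of the solution set of the
  homogeneous system.\<close>

lemma luzin_countable_affine:
  fixes G :: "(nat \<Rightarrow> 'k::field) set" and c :: "'u \<Rightarrow> 'b \<Rightarrow> 'k" and j :: "'b \<Rightarrow> nat"
  assumes G: "luzin_group G" and j: "inj_on j T"
    and c: "\<And>u. u \<in> V \<Longrightarrow> finite {b. c u b \<noteq> 0}" "\<And>u. u \<in> V \<Longrightarrow> {b. c u b \<noteq> 0} \<subseteq> T"
    and unb: "\<And>N. \<exists>u\<in>V. \<exists>b. c u b \<noteq> 0 \<and> N \<le> j b"
  shows "countable {g \<in> G. \<forall>u\<in>V. (\<Sum>b | c u b \<noteq> 0. c u b * g (j b)) = r u}" (is "countable ?X")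
proof (cases "?X = {}")
  case True
  then show ?thesis by (simp only: countable_empty)
next
  case False
  then obtain g0 where g0: "g0 \<in> ?X" by blast
  let ?Z = "{g \<in> G. \<forall>u\<in>V. (\<Sum>b | c u b \<noteq> 0. c u b * g (j b)) = 0}"
  have "seq.subspace G" using G by (simp add: luzin_group_def)
  then have "?X \<subseteq> (\<lambda>z. g0 + z) ` ?Z"
    using g0 by (auto intro!: image_eqI[of _ _ "g - g0" for g] seq.subspace_diff
      simp: right_diff_distrib sum_subtractf)
  moreover have "countable ((\<lambda>z. g0 + z) ` ?Z)"
    by (intro countable_image luzin_countable_common_zeros[OF G j c unb])
  ultimately show ?thesis by (rule countable_subset)
qed

section \<open>From a Luzin group to a strong Gross space\<close>

lemma seq_sum_scale_apply: "(\<Sum>a\<in>A. seq_scale (k a) (f a)) n = (\<Sum>a\<in>A. k a * f a n)"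
  by (induction A rule: infinite_finite_induct) (simp_all add: seq_scale_def)

lemma luzin_imp_strong_gross:
  fixes G :: "(nat \<Rightarrow> 'k::field) set"
  assumes K: "countable (UNIV :: 'k set)" and G: "luzin_group G"
  shows "\<exists>(E :: (nat \<Rightarrow> 'k) set) \<Phi>. seq.strong_gross_space E \<Phi>"
proof -
  have subG: "seq.subspace G" using G by (simp add: luzin_group_def)
  then have uncG: "uncountable G"
    using G seq.natLeq_less_cdim_iff[OF K] by (simp add: luzin_group_def)
  obtain B where B: "B \<subseteq> G" "seq.independent B" "seq.span B = G"
    using seq.cdim_basis[OF subG] by blast
  have "uncountable B" using seq.countable_span[OF K] uncG B(3) by blast
  then obtain S R where S: "S \<subseteq> B" "uncountable S" and R: "R \<subseteq> S \<times> S" "wf R" "trans R" "total_on S R"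
    and ctbl: "\<And>a. countable {b. (b, a) \<in> R}"
    by (rule uncountable_subset_countable_initial_segments) blast
  obtain d :: "(nat \<Rightarrow> 'k) \<Rightarrow> (nat \<Rightarrow> 'k) \<Rightarrow> nat" where
    inj: "\<And>a. inj_on (d a) {b. (b, a) \<in> R}" and
    coh: "\<And>a a'. (a', a) \<in> R \<Longrightarrow> finite {b. (b, a') \<in> R \<and> d a b \<noteq> d a' b}"
    using coherent_injections[OF R(2,1,3,4) ctbl] by blast
  have indS: "seq.independent S" using B(2) S(1) seq.dependent_mono by blast
  \<comment> \<open>The larger of two elements of \<open>S\<close>, itself a sequence, is read at
    the position that it assigns to the smaller one. On \<open>S\<close> the value 0 is the default
    for the diagonal.\<close>
  define \<phi> where "\<phi> a b = (if (b, a) \<in> R then a (d a b) else if (a, b) \<in> R then b (d b a) else 0)"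
    for a b
  have asym: "(a, b) \<notin> R" if "(b, a) \<in> R" for a b using wf_not_sym[OF R(2) that] .
  have \<phi>_comm: "\<phi> a b = \<phi> b a" for a b using asym by (auto simp: \<phi>_def)
  let ?E = "seq.span S" and ?r = "seq.representation S"
  define \<Phi> where "\<Phi> = seq.bilinear_extension S \<phi>"
  have sb: "seq.symmetric_bilinear_on ?E \<Phi>"
    unfolding \<Phi>_def using indS \<phi>_comm by (rule seq.symmetric_bilinear_on_bilinear_extension)
  have "uncountable ?E"
  proof
    assume "countable ?E"
    then have "countable S" using seq.span_superset by (rule countable_subset[rotated])
    then show False using S(2) by blast
  qed
  then have gt: "seq.gross_type_space ?E \<Phi>"
    using sb by (simp add: seq.gross_type_space_def seq.natLeq_less_cdim_iff[OF K])
  have "countable (seq.orthogonal_complement ?E \<Phi> U)"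
    if U: "seq.subspace U" "U \<subseteq> ?E" "countable U" "\<And>T. finite T \<Longrightarrow> \<not> U \<subseteq> seq.span T" for U
  proof -
    let ?C = "\<Union>u\<in>U. {b. ?r u b \<noteq> 0}"
    \<comment> \<open>A point of \<open>S\<close> outside this countable set lies strictly above
      every support of a vector in \<open>U\<close>.\<close>
    let ?X = "\<Union>x\<in>?C. insert x {b. (b, x) \<in> R}"
    have "countable ?C"
      by (intro countable_UN U(3)) (rule countable_finite[OF seq.finite_representation])
    then have "countable ?X" by (rule countable_UN) (intro countable_insert ctbl)
    then have "\<not> S \<subseteq> ?X" using S(2) by (auto dest: countable_subset)
    then obtain \<gamma> where \<gamma>: "\<gamma> \<in> S" "\<gamma> \<notin> ?X" by blast
    have below: "(b, \<gamma>) \<in> R" if "u \<in> U" "?r u b \<noteq> 0" for u b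
    proof -
      have "b \<in> S" using that(2) by (rule seq.representation_ne_zero)
      moreover have "b \<noteq> \<gamma>" "(\<gamma>, b) \<notin> R" using that \<gamma>(2) by auto
      ultimately show ?thesis using \<gamma>(1) R(4) unfolding total_on_def by blast
    qed
    let ?L = "{b. (b, \<gamma>) \<in> R}"
    define V where "V F = {u \<in> U. \<forall>b\<in>F. ?r u b = 0}" for F
    define H where "H y F = {h \<in> G. \<forall>u\<in>V F.
      (\<Sum>b | ?r u b \<noteq> 0. ?r u b * h (d \<gamma> b)) = - \<Phi> y u}" for y F
    have cH: "countable (H y F)" if F: "finite F" for y F
      unfolding H_def
    proof (rule luzin_countable_affine[OF G inj])
      show "finite {b. ?r u b \<noteq> 0}" for u by (rule seq.finite_representation)
      show "{b. ?r u b \<noteq> 0} \<subseteq> ?L" if "u \<in> V F" for u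
        using below that by (auto simp: V_def)
      fix N
      \<comment> \<open>Only finitely many points below \<open>\<gamma>\<close> have position less
        than \<open>N\<close>. A nonzero vector of \<open>U\<close> that vanishes on them and on
        \<open>F\<close> has a support point at position \<open>N\<close> or later.\<close>
      let ?Q = "{b \<in> ?L. d \<gamma> b < N}"
      have "finite (d \<gamma> ` ?Q)" by (rule finite_subset[of _ "{..<N}"]) auto
      moreover have "inj_on (d \<gamma>) ?Q" using inj by (rule inj_on_subset) auto
      ultimately have "finite ?Q" by (rule finite_imageD)
      then obtain u where u: "u \<in> U" "u \<noteq> 0" "\<forall>b\<in>F \<union> ?Q. ?r u b = 0"
        using seq.exists_vanishing_on_finite[OF indS U(1,2,4), of "F \<union> ?Q"] F by blast
      have "\<exists>b. ?r u b \<noteq> 0"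
      proof (rule ccontr)
        assume "\<not> ?thesis"
        then have "{b. ?r u b \<noteq> 0} = {}" by blast
        then have "u = 0"
          using seq.sum_nonzero_representation_eq[OF indS, of u] u(1) U(2) by auto
        then show False using u(2) by blast
      qed
      then obtain b where b: "?r u b \<noteq> 0" by blast
      have "N \<le> d \<gamma> b" using b u(3) below[OF u(1) b] by (auto simp: not_less[symmetric])
      then show "\<exists>u\<in>V F. \<exists>b. ?r u b \<noteq> 0 \<and> N \<le> d \<gamma> b" using u b by (auto simp: V_def)
    qed
    let ?I = "seq.span ?L \<times> {F. finite F \<and> F \<subseteq> ?L}"
    have "countable ?I"
      by (intro countable_SIGMA seq.countable_span[OF K] countable_Collect_finite_subset ctbl)
    then have "countable (\<Union>(y, F)\<in>?I. (\<lambda>h. y + h) ` H y F)"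
      by (rule countable_UN) (auto intro: cH countable_image)
    moreover have "seq.orthogonal_complement ?E \<Phi> U \<subseteq> (\<Union>(y, F)\<in>?I. (\<lambda>h. y + h) ` H y F)"
    proof
      fix e assume "e \<in> seq.orthogonal_complement ?E \<Phi> U"
      then have e: "e \<in> ?E" and perp: "\<And>u. u \<in> U \<Longrightarrow> \<Phi> e u = 0"
        by (auto simp: seq.orthogonal_complement_def)
      let ?A = "{a. ?r e a \<noteq> 0}"
      have A: "finite ?A" by (rule seq.finite_representation)
      have AS: "a \<in> S" if "?r e a \<noteq> 0" for a using that by (rule seq.representation_ne_zero)
      define y where "y = (\<Sum>a\<in>?A \<inter> ?L. seq_scale (?r e a) a)"
      define h where "h = (\<Sum>a\<in>?A - ?L. seq_scale (?r e a) a)"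
      \<comment> \<open>The points at which some \<open>a\<close> in the support of \<open>h\<close>
        assigns a position different from that of \<open>\<gamma>\<close>. Coherence makes this set
        finite.\<close>
      define F where "F = (\<Union>a\<in>?A - ?L. {b. (b, \<gamma>) \<in> R \<and> d a b \<noteq> d \<gamma> b})"
      have eyh: "e = y + h"
        unfolding y_def h_def sum.Int_Diff[OF A, of _ ?L, symmetric]
        by (rule seq.sum_nonzero_representation_eq[OF indS e, symmetric])
      have yL: "y \<in> seq.span ?L"
        unfolding y_def by (intro seq.span_sum seq.span_scale seq.span_base) simp
      have hE: "h \<in> ?E"
        unfolding h_def using AS by (intro seq.span_sum seq.span_scale seq.span_base) simp
      \<comment> \<open>As a combination of elements of \<open>S\<close>, the vector
        \<open>h\<close> is itself a sequence in the Luzin group, so the bound on solution sets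
        applies to it.\<close>
      then have hG: "h \<in> G" using seq.span_mono[OF S(1)] B(3) by blast
      have "seq.span ?L \<subseteq> ?E" using R(1) by (intro seq.span_mono) auto
      then have yE: "y \<in> ?E" using yL by blast
      have above: "a = \<gamma> \<or> (\<gamma>, a) \<in> R" if "a \<in> ?A - ?L" for a
        using that AS[of a] \<gamma>(1) R(4) unfolding total_on_def by blast
      have "finite {b. (b, \<gamma>) \<in> R \<and> d a b \<noteq> d \<gamma> b}" if "a \<in> ?A - ?L" for a
        using above[OF that] coh by auto
      then have F: "finite F" "F \<subseteq> ?L" using A by (auto simp: F_def)
      have "(\<Sum>b | ?r u b \<noteq> 0. ?r u b * h (d \<gamma> b)) = - \<Phi> y u" if u: "u \<in> V F" for u
      proof -
        have uU: "u \<in> U" and uF: "\<And>b. b \<in> F \<Longrightarrow> ?r u b = 0" using u by (auto simp: V_def)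
        then have uE: "u \<in> ?E" using U(2) by blast
        \<comment> \<open>Away from \<open>F\<close>, every \<open>a\<close> in the support of
          \<open>h\<close> is read through the same map \<open>d \<gamma>\<close>.\<close>
        have val: "\<Phi> a u = (\<Sum>b | ?r u b \<noteq> 0. ?r u b * a (d \<gamma> b))" if a: "a \<in> ?A - ?L" for a
        proof -
          have "\<Phi> a u = (\<Sum>b | ?r u b \<noteq> 0. ?r u b * \<phi> a b)"
            using seq.bilinear_extension_basis[OF indS AS] a
            by (simp add: \<Phi>_def seq.linear_extension_def)
          also have "\<dots> = (\<Sum>b | ?r u b \<noteq> 0. ?r u b * a (d \<gamma> b))"
          proof (rule sum.cong[OF refl])
            fix b assume "b \<in> {b. ?r u b \<noteq> 0}"
            then have b: "?r u b \<noteq> 0" by simp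
            then have b\<gamma>: "(b, \<gamma>) \<in> R" using below uU by blast
            then have "(b, a) \<in> R" using above[OF a] R(3) by (blast dest: transD)
            moreover have "d a b = d \<gamma> b" using b b\<gamma> uF a by (auto simp: F_def)
            ultimately show "?r u b * \<phi> a b = ?r u b * a (d \<gamma> b)" by (simp add: \<phi>_def)
          qed
          finally show ?thesis .
        qed
        have "\<Phi> h u = \<Phi> u h" using sb hE uE by (rule seq.symmetric_bilinear_onD(1))
        also have "\<dots> = (\<Sum>a\<in>?A - ?L. ?r e a * \<Phi> u a)"
          unfolding h_def
          by (rule seq.bilinear_sum_scale[OF sb seq.subspace_span uE]) (use AS in \<open>auto intro: seq.span_base\<close>)
        also have "\<dots> = (\<Sum>a\<in>?A - ?L. ?r e a * \<Phi> a u)"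
          using AS by (intro sum.cong refl arg_cong2[where f = "(*)"]
            seq.symmetric_bilinear_onD(1)[OF sb uE]) (auto intro: seq.span_base)
        also have "\<dots> = (\<Sum>a\<in>?A - ?L. \<Sum>b | ?r u b \<noteq> 0. ?r e a * (?r u b * a (d \<gamma> b)))"
          using val by (intro sum.cong refl) (simp add: sum_distrib_left)
        also have "\<dots> = (\<Sum>b | ?r u b \<noteq> 0. \<Sum>a\<in>?A - ?L. ?r e a * (?r u b * a (d \<gamma> b)))"
          by (rule sum.swap)
        also have "\<dots> = (\<Sum>b | ?r u b \<noteq> 0. ?r u b * h (d \<gamma> b))"
          \<comment> \<open>Evaluation at the fixed position \<open>d \<gamma> b\<close> is linear
            in the sequence, so the sum over \<open>a\<close> becomes an entry of
            \<open>h\<close>.\<close>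
          unfolding h_def seq_sum_scale_apply
          by (intro sum.cong refl) (simp add: sum_distrib_left mult.left_commute)
        finally have "\<Phi> h u = (\<Sum>b | ?r u b \<noteq> 0. ?r u b * h (d \<gamma> b))" .
        moreover have "\<Phi> y u + \<Phi> h u = 0"
          using perp[OF uU] seq.symmetric_bilinear_onD(2)[OF sb yE hE uE] eyh by simp
        ultimately show ?thesis by (simp add: eq_neg_iff_add_eq_0 add.commute)
      qed
      then have "h \<in> H y F" using hG by (simp add: H_def)
      moreover have "(y, F) \<in> ?I" using yL F by simp
      ultimately show "e \<in> (\<Union>(y, F)\<in>?I. (\<lambda>h. y + h) ` H y F)" using eyh by blast
    qed
    ultimately show ?thesis by (rule countable_subset[rotated])
  qed
  then have "seq.strong_gross_space ?E \<Phi>"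
    unfolding seq.strong_gross_space_def
    using gt sb by (auto simp: seq.cdim_eq_natLeq_iff[OF K] seq.cdim_le_natLeq_iff[OF K]
      seq.subspace_orthogonal_complement)
  then show ?thesis by blast
qed

text \<open>A formula cannot quantify over types, so the equivalence places the Gross spaces among
  the sequences. The second conjunct covers spaces carried by an arbitrary type; with the
  equivalence, any of them also yields one among the sequences.\<close>

theorem theoremE:
  fixes scale :: "'k::field \<Rightarrow> 'e::ab_group_add \<Rightarrow> 'e"
  assumes "countable (UNIV :: 'k set)"
  shows
    "((\<exists>(E :: (nat \<Rightarrow> 'k) set) \<Phi>. seq.strong_gross_space E \<Phi>) \<longleftrightarrow>
        (\<exists>G :: (nat \<Rightarrow> 'k) set. luzin_group G)) \<and>
     (vector_space scale \<and> (\<exists>E \<Phi>. vector_space.strong_gross_space scale E \<Phi>) \<longrightarrow>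
        (\<exists>G :: (nat \<Rightarrow> 'k) set. luzin_group G))"
  using seq.strong_gross_imp_luzin[OF assms] luzin_imp_strong_gross[OF assms]
    vector_space.strong_gross_imp_luzin[OF _ assms, of scale]
  by blast

end
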